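(* Let $k\ge1$ and let $(G,\Sigma)$ be a non-decomposable $k$-critical signed graph with at least three vertices. Then $(G,\Sigma)$ is a proper subdivision of some signed graph $(H,\Gamma)$ if and only if $G$ has a vertex with precisely two neighbors.
   Context: A signed graph $(G,\Sigma)$ is a finite graph $G$ (loops and multiple edges allowed) with a set $\Sigma\subseteq E(G)$ of negative edges. A circuit is negative if it has an odd number of edges in $\Sigma$; $(G,\Sigma)$ is balanced if it has no negative circuit. For $U\subseteq V(G)$, $\partial(U)$ is the set of edges with exactly one end in $U$; a signature of $(G,\Sigma)$ is any set $\Sigma\,\Delta\,\partial(U)$, and signed graphs are regarded up to such switching (so "$(G,\Sigma)$ is a subdivision of $(H,\Gamma)$" means $(G,\Sigma')$ is one for some signature $\Sigma'$ of $(G,\Sigma)$). The frustration index $l(G,\Sigma)$ is the minimum size of $E\subseteq E(G)$ with $(G-E,\Sigma-E)$ balanced. For $k\ge1$, $(G,\Sigma)$ is $k$-critical if $l(G,\Sigma)=k$ and $l(G-e,\Sigma-\{e\})<k$ for every $e$. A $k$-critical signed graph is decomposable if for some $n\ge2$ and positive integers $k_1,\dots,k_n$ with sum $k$ it contains pairwise edge-disjoint subgraphs $(H_i,\Sigma\cap E(H_i))$ which are $k_i$-critical; otherwise non-decomposable. A $t$-multiedge $E_{xy}$ is a set of $t\ge1$ edges between $x$ and $y$; it has a sign if all its edges are positive or all negative. Subdividing a signed $t$-multiedge $E_{xy}$: delete $E_{xy}$, add a new vertex $v$, $t$ positive edges $vx$ and $t$ edges $vy$ of the same sign as $E_{xy}$.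 A subdivision is obtained by a finite (possibly empty) sequence of such operations; a proper subdivision uses a nonempty sequence. *)

theory Defs
  imports Main
begin

(* An edge is a name whose ends form a set of one vertex (a loop) or two vertices, so that
   parallel edges and multiple loops are available.  The values of ends outside the edge set
   carry no meaning. *)
record ('v, 'e) sgraph =
  verts :: "'v set"
  edges :: "'e set"
  ends :: "'e \<Rightarrow> 'v set"
  neg :: "'e set"

definition signed_graph :: "('v, 'e) sgraph \<Rightarrow> bool" where
  "signed_graph G \<longleftrightarrow>
     finite (verts G) \<and> finite (edges G) \<and>
     (\<forall>e\<in>edges G. ends G e \<subseteq> verts G \<and> card (ends G e) \<in> {1, 2}) \<and>
     neg G \<subseteq> edges G"

definition neighbours :: "('v, 'e) sgraph \<Rightarrow> 'v \<Rightarrow> 'v set" where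
  "neighbours G v = {u. \<exists>e\<in>edges G. ends G e = {u, v}}"

(* C is the edge set of a circuit; length 1 is a loop and length 2 a pair of parallel edges. *)
definition circuit :: "('v, 'e) sgraph \<Rightarrow> 'e set \<Rightarrow> bool" where
  "circuit G C \<longleftrightarrow>
     (\<exists>vs es. es \<noteq> [] \<and> length vs = length es \<and> distinct vs \<and> distinct es \<and>
        set es = C \<and> C \<subseteq> edges G \<and>
        (\<forall>i<length es. ends G (es ! i) = {vs ! i, vs ! (Suc i mod length es)}))"

definition negative_circuit :: "('v, 'e) sgraph \<Rightarrow> 'e set \<Rightarrow> bool" where
  "negative_circuit G C \<longleftrightarrow> circuit G C \<and> odd (card (C \<inter> neg G))"

definition balanced :: "('v, 'e) sgraph \<Rightarrow> bool" where
  "balanced G \<longleftrightarrow> \<not> (\<exists>C. negative_circuit G C)"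

definition cut :: "('v, 'e) sgraph \<Rightarrow> 'v set \<Rightarrow> 'e set" where
  "cut G U = {e \<in> edges G. ends G e \<inter> U \<noteq> {} \<and> \<not> ends G e \<subseteq> U}"

definition switch :: "'v set \<Rightarrow> ('v, 'e) sgraph \<Rightarrow> ('v, 'e) sgraph" where
  "switch U G = G\<lparr>neg := sym_diff (neg G) (cut G U)\<rparr>"

definition delete_edges :: "('v, 'e) sgraph \<Rightarrow> 'e set \<Rightarrow> ('v, 'e) sgraph" where
  "delete_edges G F = G\<lparr>edges := edges G - F, neg := neg G - F\<rparr>"

definition frustration :: "('v, 'e) sgraph \<Rightarrow> nat" where
  "frustration G = Min (card ` {F. F \<subseteq> edges G \<and> balanced (delete_edges G F)})"

definition critical :: "nat \<Rightarrow> ('v, 'e) sgraph \<Rightarrow> bool" where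
  "critical k G \<longleftrightarrow>
     frustration G = k \<and> (\<forall>e\<in>edges G. frustration (delete_edges G {e}) < k)"

definition signed_subgraph :: "('v, 'e) sgraph \<Rightarrow> ('v, 'e) sgraph \<Rightarrow> bool" where
  "signed_subgraph H G \<longleftrightarrow>
     signed_graph H \<and> verts H \<subseteq> verts G \<and> edges H \<subseteq> edges G \<and>
     (\<forall>e\<in>edges H. ends H e = ends G e) \<and> neg H = neg G \<inter> edges H"

definition decomposable :: "nat \<Rightarrow> ('v, 'e) sgraph \<Rightarrow> bool" where
  "decomposable k G \<longleftrightarrow>
     (\<exists>(n::nat) (ks :: nat \<Rightarrow> nat) (Hs :: nat \<Rightarrow> ('v, 'e) sgraph).
        2 \<le> n \<and> (\<forall>i<n. 0 < ks i) \<and> (\<Sum>i<n. ks i) = k \<and>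
        (\<forall>i<n. signed_subgraph (Hs i) G \<and> critical (ks i) (Hs i)) \<and>
        (\<forall>i<n. \<forall>j<n. i \<noteq> j \<longrightarrow> edges (Hs i) \<inter> edges (Hs j) = {}))"

(* A multiedge consists of parallel edges between two distinct vertices; it need not contain
   all the edges between them.  A set of loops is not a multiedge. *)
definition multiedge :: "('v, 'e) sgraph \<Rightarrow> 'v \<Rightarrow> 'v \<Rightarrow> 'e set \<Rightarrow> bool" where
  "multiedge G x y E \<longleftrightarrow>
     x \<noteq> y \<and> E \<noteq> {} \<and> finite E \<and> E \<subseteq> edges G \<and> (\<forall>e\<in>E. ends G e = {x, y})"

definition has_sign :: "('v, 'e) sgraph \<Rightarrow> 'e set \<Rightarrow> bool" where
  "has_sign G E \<longleftrightarrow> E \<subseteq> neg G \<or> E \<inter> neg G = {}"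

(* G arises from H by subdividing the multiedge E with the new vertex v, where A and B are the
   new edges vx and vy.  The new edges may reuse the names of the deleted edges E. *)
definition subdivide_step :: "('v, 'e) sgraph \<Rightarrow> ('v, 'e) sgraph \<Rightarrow> bool" where
  "subdivide_step H G \<longleftrightarrow>
     (\<exists>x y v E A B.
        multiedge H x y E \<and> has_sign H E \<and> v \<notin> verts H \<and>
        finite A \<and> finite B \<and> card A = card E \<and> card B = card E \<and>
        A \<inter> B = {} \<and> (A \<union> B) \<inter> (edges H - E) = {} \<and>
        verts G = insert v (verts H) \<and>
        edges G = (edges H - E) \<union> A \<union> B \<and>
        (\<forall>e\<in>edges H - E. ends G e = ends H e) \<and>
        (\<forall>e\<in>A. ends G e = {v, x}) \<and>
        (\<forall>e\<in>B. ends G e = {v, y}) \<and>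
        neg G = (neg H - E) \<union> (if E \<subseteq> neg H then B else {}))"

(* Some signature of G is obtained by a nonempty sequence of subdivisions.  Keeping H in the
   types of G is no restriction on the existence of H: each step adds a vertex and edges, so a
   graph over other types, and every intermediate graph, can be renamed into those of G. *)
definition proper_subdivision :: "('v, 'e) sgraph \<Rightarrow> ('v, 'e) sgraph \<Rightarrow> bool" where
  "proper_subdivision G H \<longleftrightarrow> (\<exists>U\<subseteq>verts G. subdivide_step\<^sup>+\<^sup>+ H (switch U G))"

end

theory Submission
  imports Defs
begin

(* By Harary's theorem the frustration index is the least number of negative edges over all
   signatures.  Hence a set D of edges that contains the same number c > 0 of negative edges in
   every signature splits off: the frustration index of G - D is k - c, so a non-decomposable
   k-critical graph has no edges outside D.  Applied to a negative loop and to a pair of parallel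
   edges of opposite signs, this shows that at a vertex v with exactly two neighbours x and y there
   are no loops and that the edges vx, as well as the edges vy, all have one sign.  If there were
   more edges vy than vx, then deleting one edge vy would not lower the frustration index, because
   whenever the edges vy are negative one can switch at v.  So both multiedges have the same size,
   and suppressing v yields H. *)

lemma sum_cyclic_shift:
  fixes f :: "nat \<Rightarrow> 'a::comm_monoid_add"
  shows "(\<Sum>i<n. f (Suc i mod n)) = (\<Sum>i<n. f i)"
proof (cases n)
  case (Suc m)
  have "(\<Sum>i<Suc m. f (Suc i mod Suc m)) = (\<Sum>i<m. f (Suc i mod Suc m)) + f 0"
    by simp
  also have "(\<Sum>i<m. f (Suc i mod Suc m)) = (\<Sum>i<m. f (Suc i))"
    by (rule sum.cong) auto
  also have "(\<Sum>i<m. f (Suc i)) + f 0 = (\<Sum>i<Suc m. f i)"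
    by (simp only: sum.lessThan_Suc_shift add.commute)
  finally show ?thesis
    by (simp only: Suc)
qed simp

section \<open>Cuts and Harary's theorem\<close>

lemma neg_switch: "neg (switch U G) = sym_diff (neg G) (cut G U)"
  by (simp add: switch_def)

lemma delete_edges_simps [simp]:
  "verts (delete_edges G F) = verts G"
  "edges (delete_edges G F) = edges G - F"
  "ends (delete_edges G F) = ends G"
  "neg (delete_edges G F) = neg G - F"
  by (simp_all add: delete_edges_def)

lemma cut_delete_edges: "cut (delete_edges G F) U = cut G U - F"
  by (auto simp: cut_def)

lemma neg_switch_delete_edges:
  "neg (switch U (delete_edges G F)) = neg (switch U G) - F"
  by (auto simp: neg_switch cut_delete_edges)

lemma signed_graph_delete_edges: "signed_graph G \<Longrightarrow> signed_graph (delete_edges G F)"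
  by (auto simp: signed_graph_def)

lemma delete_edges_delete_edges: "delete_edges (delete_edges G E) F = delete_edges G (E \<union> F)"
  by (simp add: delete_edges_def Diff_eq Int_ac)

lemma cut_subset: "cut G U \<subseteq> edges G"
  by (auto simp: cut_def)

lemma neg_switch_subset: "signed_graph G \<Longrightarrow> neg (switch U G) \<subseteq> edges G"
  using cut_subset[of G U] by (auto simp: neg_switch signed_graph_def)

lemma finite_neg_switch: "signed_graph G \<Longrightarrow> finite (neg (switch U G))"
  using neg_switch_subset finite_subset signed_graph_def by metis

lemma edge_cases:
  assumes "signed_graph G" "e \<in> edges G"
  obtains a b where "ends G e = {a, b}" "a \<in> verts G" "b \<in> verts G"
proof -
  have sub: "ends G e \<subseteq> verts G" and "card (ends G e) = 1 \<or> card (ends G e) = 2"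
    using assms by (auto simp: signed_graph_def)
  then obtain a b where "ends G e = {a, b}"
    by (metis card_1_singletonE card_2_iff insert_absorb2)
  with sub that show thesis by auto
qed

lemma mem_cut_iff:
  "e \<in> edges G \<Longrightarrow> ends G e = {a, b} \<Longrightarrow> e \<in> cut G U \<longleftrightarrow> (a \<in> U) \<noteq> (b \<in> U)"
  by (auto simp: cut_def)

lemma cut_sym_diff:
  assumes "signed_graph G"
  shows "cut G (sym_diff U W) = sym_diff (cut G U) (cut G W)"
proof (rule set_eqI)
  fix e
  show "e \<in> cut G (sym_diff U W) \<longleftrightarrow> e \<in> sym_diff (cut G U) (cut G W)"
  proof (cases "e \<in> edges G")
    case True
    then obtain a b where "ends G e = {a, b}" using edge_cases[OF assms] by metis
    with True show ?thesis by (auto simp: mem_cut_iff)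
  next
    case False
    then show ?thesis by (simp add: cut_def)
  qed
qed

text \<open>An edge lies in the cut exactly when its two ends disagree about membership in
  \<open>U\<close>. Summing this disagreement modulo 2 around the circuit counts every vertex
  twice.\<close>

lemma even_card_circuit_Int_cut:
  assumes "circuit G C"
  shows "even (card (C \<inter> cut G U))"
proof -
  obtain vs es where es: "distinct es" "set es = C" "C \<subseteq> edges G"
    and ends: "\<And>i. i < length es \<Longrightarrow> ends G (es ! i) = {vs ! i, vs ! (Suc i mod length es)}"
    using assms unfolding circuit_def by blast
  define n where "n = length es"
  define f :: "nat \<Rightarrow> nat" where "f i = of_bool (vs ! i \<in> U)" for i
  have "card (C \<inter> cut G U) = (\<Sum>e\<in>C. of_bool (e \<in> cut G U))"
    by (simp add: Int_def flip: es(2))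
  also have "\<dots> = (\<Sum>i<n. of_bool (es ! i \<in> cut G U))"
    by (rule sum.reindex_bij_betw[OF bij_betw_nth, symmetric]) (use es n_def in auto)
  finally have card: "card (C \<inter> cut G U) = (\<Sum>i<n. of_bool (es ! i \<in> cut G U))" .
  \<comment> \<open>\<open>f\<close> is the indicator of \<open>U\<close> along the circuit, so the
    cut indicator of the \<open>i\<close>-th edge is congruent modulo 2 to \<open>f i\<close> plus
    its cyclic successor.\<close>
  have "even (of_bool (es ! i \<in> cut G U) + (f i + f (Suc i mod n)))" if "i < n" for i
  proof -
    have "es ! i \<in> edges G" using that es n_def by auto
    from mem_cut_iff[OF this ends, of U] that show ?thesis by (auto simp: f_def n_def)
  qed
  then have "even (\<Sum>i<n. of_bool (es ! i \<in> cut G U) + (f i + f (Suc i mod n)))"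
    by (intro dvd_sum) auto
  also have "(\<Sum>i<n. of_bool (es ! i \<in> cut G U) + (f i + f (Suc i mod n)))
      = card (C \<inter> cut G U) + 2 * (\<Sum>i<n. f i)"
    by (simp add: card sum.distrib sum_cyclic_shift)
  finally show ?thesis by simp
qed

section \<open>Paths and reachability\<close>

definition path :: "('v, 'e) sgraph \<Rightarrow> 'v list \<Rightarrow> 'e list \<Rightarrow> bool" where
  "path G vs es \<longleftrightarrow> length vs = Suc (length es) \<and> distinct vs \<and> distinct es \<and> set es \<subseteq> edges G \<and>
     (\<forall>i<length es. ends G (es ! i) = {vs ! i, vs ! Suc i})"

lemma path_take:
  assumes "path G vs es" "j < length vs"
  shows "path G (take (Suc j) vs) (take j es)"
  using assms set_take_subset[of j es] by (fastforce simp: path_def)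

lemma path_snoc:
  assumes "path G vs es" "e \<in> edges G" "ends G e = {last vs, w}" "w \<notin> set vs"
  shows "path G (vs @ [w]) (es @ [e])"
proof -
  have "e \<notin> set es"
  proof
    assume "e \<in> set es"
    then obtain i where "i < length es" "es ! i = e" by (auto simp: in_set_conv_nth)
    then have "ends G e = {vs ! i, vs ! Suc i}" "{vs ! i, vs ! Suc i} \<subseteq> set vs"
      using assms(1) by (auto simp: path_def)
    with assms(3,4) show False by auto
  qed
  moreover have "last vs = vs ! length es"
    using assms(1) by (metis diff_Suc_1 last_conv_nth length_0_conv nat.distinct(1) path_def)
  ultimately show ?thesis
    using assms by (auto simp: path_def nth_append less_Suc_eq)
qed

definition reachable :: "('v, 'e) sgraph \<Rightarrow> 'v \<Rightarrow> 'v set" where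
  "reachable G a = {w. \<exists>vs es. path G vs es \<and> hd vs = a \<and> last vs = w}"

lemma self_in_reachable: "a \<in> reachable G a"
proof -
  have "path G [a] []" by (simp add: path_def)
  then show ?thesis unfolding reachable_def by force
qed

text \<open>Paths may not repeat vertices, so there are two cases: if \<open>w\<close> already lies
  on the path to \<open>u\<close>, the path is cut off at \<open>w\<close>; otherwise it is extended
  by \<open>e\<close>.\<close>

lemma reachable_step:
  assumes "u \<in> reachable G a" "e \<in> edges G" "ends G e = {u, w}"
  shows "w \<in> reachable G a"
proof -
  obtain vs es where p: "path G vs es" "hd vs = a" "last vs = u"
    using assms(1) unfolding reachable_def by blast
  have ne: "vs \<noteq> []" using p(1) by (auto simp: path_def)
  show ?thesis
  proof (cases "w \<in> set vs")
    case True
    then obtain j where j: "j < length vs" "vs ! j = w" by (auto simp: in_set_conv_nth)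
    have "path G (take (Suc j) vs) (take j es)" using path_take p(1) j(1) by blast
    moreover have "hd (take (Suc j) vs) = a" "last (take (Suc j) vs) = w"
      using j p(2) ne by (auto simp: take_Suc_conv_app_nth hd_append hd_conv_nth)
    ultimately show ?thesis unfolding reachable_def by blast
  next
    case False
    have "path G (vs @ [w]) (es @ [e])" using path_snoc[OF p(1) assms(2)] assms(3) p(3) False by simp
    moreover have "hd (vs @ [w]) = a" "last (vs @ [w]) = w" using ne p(2) by auto
    ultimately show ?thesis unfolding reachable_def by blast
  qed
qed

text \<open>The vertex list of a path is one entry longer than its edge list, so appending
  \<open>e\<close> gives lists of equal length, as a circuit requires. A path with a single vertex
  is closed to a loop.\<close>

lemma circuit_of_path:
  assumes "path G vs es" "e \<in> edges G" "e \<notin> set es" "ends G e = {hd vs, last vs}"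
  shows "circuit G (insert e (set es))"
proof -
  have len: "length vs = Suc (length es)" "vs \<noteq> []" using assms(1) by (auto simp: path_def)
  then have "ends G e = {vs ! length es, vs ! 0}"
    using assms(4) by (simp add: hd_conv_nth last_conv_nth insert_commute)
  moreover have "Suc i mod Suc (length es) = Suc i" if "i < length es" for i
    using that by simp
  ultimately show ?thesis
    unfolding circuit_def using assms(1-3) len
    by (intro exI[of _ vs] exI[of _ "es @ [e]"])
      (simp add: path_def nth_append less_Suc_eq all_conj_distrib imp_conjR)
qed

section \<open>Balance in terms of cuts\<close>

lemma balanced_delete_edges:
  assumes "balanced G"
  shows "balanced (delete_edges G F)"
proof -
  have "negative_circuit G C" if "negative_circuit (delete_edges G F) C" for C
  proof -
    have C: "circuit (delete_edges G F) C" using that by (simp add: negative_circuit_def)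
    then obtain vs es where "es \<noteq> []" "length vs = length es" "distinct vs" "distinct es"
      "set es = C" "C \<subseteq> edges G - F"
      "\<forall>i<length es. ends G (es ! i) = {vs ! i, vs ! (Suc i mod length es)}"
      by (auto simp: circuit_def)
    then have "circuit G C" "C \<subseteq> edges G - F"
      unfolding circuit_def by blast+
    moreover then have "C \<inter> neg (delete_edges G F) = C \<inter> neg G" by auto
    ultimately show ?thesis using that by (simp add: negative_circuit_def)
  qed
  with assms show ?thesis by (auto simp: balanced_def)
qed

text \<open>Induction on the number of edges: after deleting \<open>e\<close>, the negative edges
  form the cut of some \<open>U\<close>. If \<open>e\<close> disagrees with this cut, then no path
  avoiding \<open>e\<close> joins its ends, since \<open>e\<close> would close such a path to a
  negative circuit. Then \<open>e\<close> by itself is a cut, by which \<open>U\<close> can be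
  corrected.\<close>

lemma balanced_imp_neg_eq_cut:
  assumes "signed_graph G" "balanced G"
  shows "\<exists>U. neg G = cut G U"
  using assms
proof (induction "card (edges G)" arbitrary: G)
  case 0
  then have "edges G = {}" by (auto simp: signed_graph_def)
  with 0 show ?case by (auto simp: signed_graph_def cut_def)
next
  case (Suc n)
  then obtain e where e: "e \<in> edges G" by fastforce
  let ?G = "delete_edges G {e}"
  have "n = card (edges ?G)" using Suc e by (auto simp: signed_graph_def)
  then obtain U where U: "neg ?G = cut ?G U"
    using Suc signed_graph_delete_edges balanced_delete_edges by metis
  then have rest: "f \<in> neg G \<longleftrightarrow> f \<in> cut G U" if "f \<noteq> e" for f
    using that by (auto simp: cut_delete_edges)
  obtain a b where ab: "ends G e = {a, b}" using edge_cases[OF Suc(3) e] by metis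
  show ?case
  proof (cases "e \<in> neg G \<longleftrightarrow> e \<in> cut G U")
    case True
    with rest have "neg G = cut G U" by (metis set_eqI)
    then show ?thesis ..
  next
    case False
    let ?W = "reachable ?G a"
    have "b \<notin> ?W"
    proof
      assume "b \<in> ?W"
      then obtain vs es where p: "path ?G vs es" "hd vs = a" "last vs = b"
        unfolding reachable_def by blast
      have "path G vs es" "e \<notin> set es" using p(1) by (auto simp: path_def)
      then have circ: "circuit G (insert e (set es))" (is "circuit G ?C")
        using circuit_of_path e ab p by metis
      \<comment> \<open>On the circuit, the negative edges differ from the cut of \<open>U\<close>
        in \<open>e\<close> alone, and the cut meets the circuit evenly.\<close>
      have "?C \<inter> neg G = sym_diff (?C \<inter> cut G U) {e}"
        using False rest by blast
      moreover have "odd (card (sym_diff (?C \<inter> cut G U) {e}))"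
      proof (cases "e \<in> cut G U")
        case True
        then have "sym_diff (?C \<inter> cut G U) {e} = ?C \<inter> cut G U - {e}" by blast
        moreover have "card (?C \<inter> cut G U) = Suc (card (?C \<inter> cut G U - {e}))"
          using True by (intro card.remove) auto
        ultimately show ?thesis
          using even_card_circuit_Int_cut[OF circ, of U] by simp
      next
        case False
        then have "sym_diff (?C \<inter> cut G U) {e} = insert e (?C \<inter> cut G U)" by blast
        moreover have "card (insert e (?C \<inter> cut G U)) = Suc (card (?C \<inter> cut G U))"
          using False by (intro card_insert_disjoint) auto
        ultimately show ?thesis
          using even_card_circuit_Int_cut[OF circ, of U] by simp
      qed
      ultimately have "negative_circuit G ?C" using circ by (simp add: negative_circuit_def)
      with Suc(4) show False by (auto simp: balanced_def)
    qed
    moreover have "a \<in> ?W" by (rule self_in_reachable)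
    moreover have "f \<notin> cut G ?W" if f: "f \<in> edges G" "f \<noteq> e" for f
    proof -
      obtain c d where cd: "ends G f = {c, d}" using edge_cases[OF Suc(3) f(1)] by metis
      then have "c \<in> ?W \<longleftrightarrow> d \<in> ?W"
        using reachable_step[of _ ?G a f] f by (auto simp: insert_commute)
      with cd f show ?thesis by (simp add: mem_cut_iff)
    qed
    ultimately have "cut G ?W = {e}"
      using mem_cut_iff[OF e ab] cut_subset[of G ?W] by blast
    \<comment> \<open>Combining \<open>U\<close> with \<open>?W\<close> changes the cut in
      \<open>e\<close> only, exactly where it was wrong.\<close>
    then have "neg G = cut G (sym_diff U ?W)"
      using False rest unfolding cut_sym_diff[OF Suc(3)] by (intro set_eqI) (metis Diff_iff Un_iff singleton_iff)
    then show ?thesis ..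
  qed
qed

lemma balanced_iff_neg_eq_cut:
  assumes "signed_graph G"
  shows "balanced G \<longleftrightarrow> (\<exists>U. neg G = cut G U)"
  using balanced_imp_neg_eq_cut[OF assms] even_card_circuit_Int_cut
  by (fastforce simp: balanced_def negative_circuit_def)

section \<open>The frustration index\<close>

text \<open>By Harary's theorem, balance after deleting \<open>F\<close> means that
  \<open>neg G\<close> and some cut agree outside \<open>F\<close>, so that their symmetric
  difference, the negative set of a signature, lies in \<open>F\<close>.\<close>

lemma balanced_delete_edges_iff:
  assumes "signed_graph G"
  shows "balanced (delete_edges G F) \<longleftrightarrow> (\<exists>U. neg (switch U G) \<subseteq> F)"
  unfolding balanced_iff_neg_eq_cut[OF signed_graph_delete_edges[OF assms]]
  by (rule arg_cong[of _ _ Ex]) (auto simp: neg_switch cut_delete_edges fun_eq_iff)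

text \<open>The negative set of any signature is a deletion set that achieves balance, and every
  such deletion set contains one of these. The two minima therefore coincide, and all later
  arguments count negative edges of signatures.\<close>

lemma
  assumes "signed_graph G"
  shows frustration_le: "frustration G \<le> card (neg (switch U G))"
    and frustration_attained: "\<exists>U. frustration G = card (neg (switch U G))"
proof -
  let ?\<F> = "{F. F \<subseteq> edges G \<and> balanced (delete_edges G F)}"
  have fin: "finite (card ` ?\<F>)" using assms by (auto simp: signed_graph_def)
  have mem: "neg (switch U G) \<in> ?\<F>" for U
    using assms by (auto simp: balanced_delete_edges_iff neg_switch_subset)
  show le: "frustration G \<le> card (neg (switch U G))" for U
    unfolding frustration_def by (rule Min_le[OF fin]) (use mem in blast)
  have "frustration G \<in> card ` ?\<F>"
    unfolding frustration_def by (rule Min_in[OF fin]) (use mem in blast)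
  then obtain F U where F: "F \<subseteq> edges G" "frustration G = card F" "neg (switch U G) \<subseteq> F"
    using assms by (auto simp: balanced_delete_edges_iff)
  then have "card (neg (switch U G)) \<le> card F"
    using assms by (intro card_mono) (auto simp: signed_graph_def intro: finite_subset)
  with le[of U] F have "frustration G = card (neg (switch U G))" by simp
  then show "\<exists>U. frustration G = card (neg (switch U G))" ..
qed

lemma le_frustrationI:
  assumes "signed_graph G" "\<And>U. k \<le> card (neg (switch U G))"
  shows "k \<le> frustration G"
  using assms frustration_attained by metis

lemma frustration_delete_edges_le:
  assumes "signed_graph G"
  shows "frustration (delete_edges G F) \<le> frustration G"
proof -
  obtain U where "frustration G = card (neg (switch U G))"
    using frustration_attained[OF assms] ..
  moreover have "card (neg (switch U G) - F) \<le> card (neg (switch U G))"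
    using finite_neg_switch[OF assms] by (intro card_mono) auto
  ultimately show ?thesis
    using frustration_le[OF signed_graph_delete_edges[OF assms], of F U]
    by (simp add: neg_switch_delete_edges)
qed

lemma signed_subgraph_delete_edges:
  "signed_graph G \<Longrightarrow> signed_subgraph (delete_edges G F) G"
  by (auto simp: signed_subgraph_def signed_graph_delete_edges signed_graph_def)

text \<open>Edges whose deletion does not lower the frustration index are removed one after another
  until none is left.\<close>

lemma critical_subgraph_exists:
  assumes "signed_graph G"
  shows "\<exists>F. critical (frustration G) (delete_edges G F)"
  using assms
proof (induction "card (edges G)" arbitrary: G rule: less_induct)
  case less
  show ?case
  proof (cases "critical (frustration G) G")
    case True
    moreover have "delete_edges G {} = G" by (simp add: delete_edges_def)
    ultimately show ?thesis by metis
  next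
    case False
    then obtain e where e: "e \<in> edges G" "frustration (delete_edges G {e}) = frustration G"
      using frustration_delete_edges_le[OF less(2)]
      by (auto simp: critical_def not_less intro: le_antisym)
    have "card (edges (delete_edges G {e})) < card (edges G)"
      using less(2) e card_Diff1_less[of "edges G" e] by (simp add: signed_graph_def)
    from less(1)[OF this signed_graph_delete_edges[OF less(2)]]
    show ?thesis using e(2) by (auto simp: delete_edges_delete_edges)
  qed
qed

section \<open>Non-decomposable critical signed graphs\<close>

text \<open>The two parts need not be critical themselves: each contains a critical subgraph of the
  same frustration index, and these two subgraphs form the decomposition.\<close>

lemma decomposableI:
  assumes "signed_graph G" "disjnt D E"
    and "frustration (delete_edges G (edges G - D)) + frustration (delete_edges G (edges G - E)) = k"
    and "0 < frustration (delete_edges G (edges G - D))"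
    and "0 < frustration (delete_edges G (edges G - E))"
  shows "decomposable k G"
proof -
  \<comment> \<open>\<open>?K D\<close> keeps exactly the edges of \<open>G\<close> that lie in
    \<open>D\<close>, and all vertices.\<close>
  let ?K = "\<lambda>D. delete_edges G (edges G - D)"
  obtain F where F: "critical (frustration (?K D)) (delete_edges (?K D) F)"
    using critical_subgraph_exists signed_graph_delete_edges[OF assms(1)] by blast
  obtain F' where F': "critical (frustration (?K E)) (delete_edges (?K E) F')"
    using critical_subgraph_exists signed_graph_delete_edges[OF assms(1)] by blast
  let ?Hs = "\<lambda>i::nat. if i = 0 then delete_edges (?K D) F else delete_edges (?K E) F'"
  let ?ks = "\<lambda>i::nat. frustration (if i = 0 then ?K D else ?K E)"
  have less_2: "i < 2 \<longleftrightarrow> i = 0 \<or> i = 1" for i :: nat by auto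
  have "\<forall>i<2. signed_subgraph (?Hs i) G \<and> critical (?ks i) (?Hs i)"
    using F F' assms(1) by (auto simp: delete_edges_delete_edges signed_subgraph_delete_edges)
  moreover have "(\<Sum>i<2. ?ks i) = k" using assms(3) by (simp add: numeral_2_eq_2)
  moreover have "\<forall>i<2. \<forall>j<2. i \<noteq> j \<longrightarrow> edges (?Hs i) \<inter> edges (?Hs j) = {}"
    using assms(2) by (auto simp: less_2 disjnt_def)
  moreover have "\<forall>i<2. 0 < ?ks i" using assms(4,5) by simp
  ultimately show ?thesis
    unfolding decomposable_def
    by (intro exI[of _ "2::nat"] exI[of _ ?ks] exI[of _ ?Hs] conjI order_refl)
qed

text \<open>Every signature has \<open>c\<close> negative edges in \<open>D\<close>, so minimizing
  over signatures only concerns the rest: the indices of the two parts are \<open>c\<close> and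
  \<open>k - c\<close>. Non-decomposability forces \<open>k = c\<close>, and then deleting an edge
  outside \<open>D\<close> could not lower the index.\<close>

lemma edges_eq_if_constant_part:
  assumes G: "signed_graph G" "critical k G" "\<not> decomposable k G"
    and D: "D \<subseteq> edges G" "0 < c" "\<And>U. card (neg (switch U G) \<inter> D) = c"
  shows "edges G = D"
proof (rule ccontr)
  assume "edges G \<noteq> D"
  then obtain e where e: "e \<in> edges G" "e \<notin> D" using D(1) by blast
  let ?H = "delete_edges G (edges G - D)" and ?K = "delete_edges G D"
  note sg = signed_graph_delete_edges[OF G(1)]
  have "neg (switch U ?H) = neg (switch U G) \<inter> D" for U
    using neg_switch_subset[OF G(1), of U] by (auto simp: neg_switch_delete_edges)
  then have H: "frustration ?H = c" using frustration_attained[OF sg] D(3) by metis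
  have K: "delete_edges G (edges G - (edges G - D)) = ?K"
    using D(1) by (simp add: double_diff)
  have split: "card (neg (switch U G)) = c + card (neg (switch U ?K))" for U
    using card_Int_Diff[OF finite_neg_switch[OF G(1)], of U D] D(3)
    by (simp add: neg_switch_delete_edges)
  obtain U where "frustration ?K = card (neg (switch U ?K))"
    using frustration_attained[OF sg] by metis
  then have "k \<le> c + frustration ?K"
    using frustration_le[OF G(1), of U] G(2) by (simp add: split critical_def)
  moreover obtain U where "frustration G = card (neg (switch U G))"
    using frustration_attained[OF G(1)] ..
  then have "c + frustration ?K \<le> k"
    using frustration_le[OF sg, of D U] G(2) by (simp add: split critical_def)
  ultimately have k: "c + frustration ?K = k" by simp
  \<comment> \<open>Otherwise \<open>D\<close> and its complement would both have positive index,
    with sum \<open>k\<close>.\<close>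
  have "frustration ?K = 0"
  proof (rule ccontr)
    assume "frustration ?K \<noteq> 0"
    then have "decomposable k G"
      using H K k D(2) by (intro decomposableI[OF G(1), of D "edges G - D"]) (auto simp: disjnt_def)
    with G(3) show False ..
  qed
  have "c \<le> frustration (delete_edges G {e})"
  proof (rule le_frustrationI[OF sg])
    fix U
    have "card (neg (switch U G) \<inter> D) \<le> card (neg (switch U G) - {e})"
      using finite_neg_switch[OF G(1)] e(2) by (intro card_mono) auto
    then show "c \<le> card (neg (switch U (delete_edges G {e})))"
      by (simp add: D(3) neg_switch_delete_edges)
  qed
  with k \<open>frustration ?K = 0\<close> G(2) e(1) show False by (force simp: critical_def)
qed

text \<open>If \<open>e\<close> were positive in every signature, deleting it would not change the
  number of negative edges of any signature.\<close>

lemma critical_edge_in_neg_switch: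
  assumes "signed_graph G" "critical k G" "e \<in> edges G"
  shows "\<exists>U. e \<in> neg (switch U G)"
proof (rule ccontr)
  assume "\<nexists>U. e \<in> neg (switch U G)"
  then have "k \<le> card (neg (switch U (delete_edges G {e})))" for U
    using frustration_le[OF assms(1), of U] assms(2)
    by (simp add: neg_switch_delete_edges critical_def)
  then have "k \<le> frustration (delete_edges G {e})"
    by (rule le_frustrationI[OF signed_graph_delete_edges[OF assms(1)]])
  with assms(2,3) show False by (force simp: critical_def)
qed

text \<open>A loop lies in no cut, so its sign is the same in all signatures; by criticality this
  sign is negative.\<close>

lemma edges_eq_loop:
  assumes G: "signed_graph G" "critical k G" "\<not> decomposable k G"
    and e: "e \<in> edges G" "ends G e = {v}"
  shows "edges G = {e}"
proof (rule edges_eq_if_constant_part[OF G, of _ 1])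
  have not_cut: "e \<notin> cut G U" for U using e by (auto simp: cut_def)
  obtain U where "e \<in> neg (switch U G)" using critical_edge_in_neg_switch[OF G(1,2) e(1)] ..
  with not_cut have "neg (switch U' G) \<inter> {e} = {e}" for U' by (auto simp: neg_switch)
  then show "card (neg (switch U' G) \<inter> {e}) = 1" for U' by simp
qed (use e in auto)

text \<open>Parallel edges lie in the same cuts, so two of opposite signs contribute exactly one
  negative edge to every signature.\<close>

lemma edges_eq_digon:
  assumes G: "signed_graph G" "critical k G" "\<not> decomposable k G"
    and e: "e \<in> edges G" "e \<in> neg G" and f: "f \<in> edges G" "f \<notin> neg G"
    and parallel: "ends G e = ends G f"
  shows "edges G = {e, f}"
proof (rule edges_eq_if_constant_part[OF G, of _ 1])
  fix U
  have "e \<in> cut G U \<longleftrightarrow> f \<in> cut G U" using e f parallel by (auto simp: cut_def)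
  then have "neg (switch U G) \<inter> {e, f} = (if e \<in> cut G U then {f} else {e})"
    using e f by (auto simp: neg_switch)
  then show "card (neg (switch U G) \<inter> {e, f}) = 1" by simp
qed (use e f in auto)

text \<open>If \<open>B\<close> were larger, take an edge \<open>e\<close> of \<open>B\<close>. A
  signature with \<open>e\<close> negative has all of \<open>B\<close> negative, and switching at
  \<open>v\<close> trades these for at most \<open>card A\<close> negative edges. Such a signature
  thus has more than \<open>k\<close> negative edges and can spare \<open>e\<close>, contrary to
  criticality. The edges of \<open>A\<close> may have mixed signs.\<close>

lemma vertex_multiedge_card_le:
  assumes G: "signed_graph G" "critical k G"
    and cut: "cut G {v} = A \<union> B" "A \<inter> B = {}"
    and ends: "\<And>e. e \<in> B \<Longrightarrow> ends G e = {v, y}"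
    and sign: "has_sign G B"
  shows "card B \<le> card A"
proof (rule ccontr)
  assume less: "\<not> card B \<le> card A"
  have AB: "A \<subseteq> edges G" "B \<subseteq> edges G" using cut cut_subset[of G "{v}"] by auto
  then have fin: "finite A" "finite B" using G(1) finite_subset by (auto simp: signed_graph_def)
  obtain e where e: "e \<in> B" using less by (cases "B = {}") auto
  have "k \<le> frustration (delete_edges G {e})"
  proof (rule le_frustrationI[OF signed_graph_delete_edges[OF G(1)]])
    fix U
    \<comment> \<open>\<open>?T\<close> is the negative set obtained from \<open>?S\<close> by a
      further switch at \<open>v\<close>.\<close>
    let ?S = "neg (switch U G)" and ?T = "neg (switch (sym_diff U {v}) G)"
    have finS: "finite ?S" using finite_neg_switch[OF G(1)] .
    have k: "k \<le> card ?S" "k \<le> card ?T"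
      using frustration_le[OF G(1)] G(2) by (auto simp: critical_def)
    have "k \<le> card (?S - {e})"
    proof (cases "e \<in> ?S")
      case True
      have "B \<subseteq> ?S"
      proof
        fix f
        assume f: "f \<in> B"
        then have "f \<in> cut G U \<longleftrightarrow> e \<in> cut G U"
          using AB ends e by (simp add: cut_def subset_iff)
        moreover have "f \<in> neg G \<longleftrightarrow> e \<in> neg G"
          using e f sign by (auto simp: has_sign_def)
        ultimately show "f \<in> ?S" using True by (simp add: neg_switch)
      qed
      have "?T = sym_diff ?S (A \<union> B)"
        unfolding neg_switch cut_sym_diff[OF G(1)] cut by blast
      with \<open>B \<subseteq> ?S\<close> have "?T \<subseteq> (?S - B) \<union> A" by blast
      then have "card ?T \<le> card ((?S - B) \<union> A)"
        using finS fin by (intro card_mono) auto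
      also have "\<dots> \<le> card (?S - B) + card A" by (rule card_Un_le)
      also have "card (?S - B) = card ?S - card B"
        using \<open>B \<subseteq> ?S\<close> fin by (intro card_Diff_subset) auto
      finally have "card ?T \<le> card ?S - card B + card A" .
      moreover have "card B \<le> card ?S" using \<open>B \<subseteq> ?S\<close> finS by (intro card_mono)
      ultimately show ?thesis using k less True by simp
    next
      case False
      with k show ?thesis by simp
    qed
    then show "k \<le> card (neg (switch U (delete_edges G {e})))"
      by (simp add: neg_switch_delete_edges)
  qed
  with G(2) e AB show False by (force simp: critical_def)
qed

section \<open>Subdivisions\<close>

text \<open>The new vertex is the one with two neighbours, as no old edge reaches it.
  Well-formedness of the result lets the step be iterated.\<close>

lemma subdivide_step_signed_graph:
  assumes "signed_graph H" "subdivide_step H G"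
  shows "signed_graph G"
    and "\<exists>v\<in>verts G. card (neighbours G v) = 2"
proof -
  obtain x y v E A B where E: "multiedge H x y E" and v: "v \<notin> verts H"
    and fin: "finite A" "finite B" and card: "card A = card E" "card B = card E"
    and G: "verts G = insert v (verts H)" "edges G = (edges H - E) \<union> A \<union> B"
      "\<forall>e\<in>edges H - E. ends G e = ends H e" "\<forall>e\<in>A. ends G e = {v, x}" "\<forall>e\<in>B. ends G e = {v, y}"
      "neg G = (neg H - E) \<union> (if E \<subseteq> neg H then B else {})"
    using assms(2) unfolding subdivide_step_def by (elim exE conjE) (rule that; assumption)
  have H: "\<And>e. e \<in> edges H \<Longrightarrow> ends H e \<subseteq> verts H \<and> card (ends H e) \<in> {1, 2}"
    "finite (verts H)" "finite (edges H)" "neg H \<subseteq> edges H"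
    using assms(1) by (auto simp: signed_graph_def)
  have xy: "x \<noteq> y" "x \<in> verts H" "y \<in> verts H"
    using E H(1) by (fastforce simp: multiedge_def)+
  then have "v \<noteq> x" "v \<noteq> y" using v by auto
  have "E \<noteq> {}" "finite E" using E by (auto simp: multiedge_def)
  then have "A \<noteq> {}" "B \<noteq> {}" using card by auto
  have "ends G e \<subseteq> verts G \<and> card (ends G e) \<in> {1, 2}" if "e \<in> edges G" for e
    using that G H(1)[of e] xy \<open>v \<noteq> x\<close> \<open>v \<noteq> y\<close> by auto
  then show "signed_graph G"
    using G H fin by (auto simp: signed_graph_def)
  have "u \<in> neighbours G v \<longleftrightarrow> u = x \<or> u = y" for u
  proof
    assume "u \<in> neighbours G v"
    then obtain e where e: "e \<in> edges G" "ends G e = {u, v}" by (auto simp: neighbours_def)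
    then have "e \<in> A \<or> e \<in> B" using G H(1)[of e] v by auto
    then show "u = x \<or> u = y" using G e by (auto simp: doubleton_eq_iff)
  next
    assume "u = x \<or> u = y"
    then show "u \<in> neighbours G v"
      using G \<open>A \<noteq> {}\<close> \<open>B \<noteq> {}\<close> by (auto simp: neighbours_def insert_commute)
  qed
  then have "neighbours G v = {x, y}" by blast
  then have "card (neighbours G v) = 2" using xy by simp
  then show "\<exists>v\<in>verts G. card (neighbours G v) = 2" using G by blast
qed

lemma proper_subdivision_neighbours:
  assumes "signed_graph H" "proper_subdivision G H"
  shows "\<exists>v\<in>verts G. card (neighbours G v) = 2"
proof -
  obtain U where U: "subdivide_step\<^sup>+\<^sup>+ H (switch U G)"
    using assms(2) unfolding proper_subdivision_def by blast
  have "signed_graph K \<and> (\<exists>v\<in>verts K. card (neighbours K v) = 2)" if "subdivide_step\<^sup>+\<^sup>+ H K" for K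
    using that
    by (induction rule: tranclp_induct) (use subdivide_step_signed_graph assms(1) in blast)+
  \<comment> \<open>The vertex comes from the last subdivision. Switching changes no adjacency, so
    it also serves for \<open>G\<close>.\<close>
  from this[OF U] show ?thesis by (simp add: switch_def neighbours_def)
qed

lemma subdivide_step_exists:
  fixes G :: "('v, 'e) sgraph"
  assumes G: "signed_graph G" and v: "v \<in> verts G" "v \<noteq> x" "v \<noteq> y" "x \<noteq> y"
    and A: "A = {e \<in> edges G. ends G e = {v, x}}" "A \<noteq> {}" "A \<inter> neg G = {}"
    and B: "B = {e \<in> edges G. ends G e = {v, y}}" "has_sign G B"
    and card: "card A = card B"
    and only: "\<And>e. e \<in> edges G \<Longrightarrow> v \<in> ends G e \<Longrightarrow> e \<in> A \<union> B"
  shows "\<exists>H :: ('v, 'e) sgraph. signed_graph H \<and> subdivide_step H G"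
proof -
  have fin: "finite (edges G)" "finite (verts G)" using G by (auto simp: signed_graph_def)
  have finAB: "finite A" "finite B" using fin A(1) B(1) by auto
  have "B \<noteq> {}" using card A(2) finAB by auto
  have disj: "A \<inter> B = {}" using A(1) B(1) v(4) by (auto simp: doubleton_eq_iff)
  have xy: "x \<in> verts G" "y \<in> verts G"
    using A(1,2) B(1) \<open>B \<noteq> {}\<close> G by (auto simp: signed_graph_def)
  \<comment> \<open>Suppress \<open>v\<close>: the names in \<open>A\<close> are reused for the new
    edges between \<open>x\<close> and \<open>y\<close>, which take over the sign of
    \<open>B\<close>. Edges of \<open>G\<close> that already join \<open>x\<close> and
    \<open>y\<close> stay outside this multiedge.\<close>
  define H :: "('v, 'e) sgraph" where
    "H = \<lparr>verts = verts G - {v}, edges = edges G - B,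
      ends = (\<lambda>e. if e \<in> A then {x, y} else ends G e),
      neg = (neg G - B) \<union> (if B \<subseteq> neg G then A else {})\<rparr>"
  have H_ends: "ends H e \<subseteq> verts H \<and> card (ends H e) \<in> {1, 2}" if "e \<in> edges H" for e
  proof (cases "e \<in> A")
    case True
    then show ?thesis using xy v by (auto simp: H_def)
  next
    case False
    with that have "e \<in> edges G" "v \<notin> ends G e" using only by (auto simp: H_def)
    with False G show ?thesis by (auto simp: H_def signed_graph_def)
  qed
  have "signed_graph H"
    unfolding signed_graph_def
    using H_ends fin disj A(1) G by (auto simp: H_def signed_graph_def)
  moreover have "multiedge H x y A"
    using v A disj finAB by (auto simp: multiedge_def H_def)
  moreover have "has_sign H A" using A(3) by (auto simp: has_sign_def H_def)
  moreover have "neg G = (neg H - A) \<union> (if A \<subseteq> neg H then B else {})"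
    using A(2,3) B(2) disj by (auto simp: H_def has_sign_def)
  moreover have "verts G = insert v (verts H)" "edges G = (edges H - A) \<union> A \<union> B"
    "v \<notin> verts H" "(A \<union> B) \<inter> (edges H - A) = {}" "\<forall>e\<in>edges H - A. ends G e = ends H e"
    using v(1) A(1) B(1) by (auto simp: H_def)
  moreover have "\<forall>e\<in>A. ends G e = {v, x}" "\<forall>e\<in>B. ends G e = {v, y}" using A(1) B(1) by auto
  ultimately show ?thesis
    unfolding subdivide_step_def using finAB disj card by metis
qed

theorem theorem3p3:
  fixes G :: "('v, 'e) sgraph" and k :: nat
  assumes "signed_graph G"
    and "1 \<le> k"
    and "critical k G"
    and "\<not> decomposable k G"
    and "3 \<le> card (verts G)"
  shows "(\<exists>H :: ('v, 'e) sgraph. signed_graph H \<and> proper_subdivision G H) \<longleftrightarrow>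
         (\<exists>v\<in>verts G. card (neighbours G v) = 2)"
proof
  assume "\<exists>H :: ('v, 'e) sgraph. signed_graph H \<and> proper_subdivision G H"
  then show "\<exists>v\<in>verts G. card (neighbours G v) = 2"
    using proper_subdivision_neighbours by blast
next
  note G = assms(1,3,4)
  assume "\<exists>v\<in>verts G. card (neighbours G v) = 2"
  then obtain v x y where v: "v \<in> verts G" and nb: "neighbours G v = {x, y}" and "x \<noteq> y"
    by (auto simp: card_2_iff)
  have no_loop: "ends G e \<noteq> {v}" if "e \<in> edges G" for e
  proof
    assume "ends G e = {v}"
    \<comment> \<open>The loop would be the only edge of \<open>G\<close>.\<close>
    then have "neighbours G v \<subseteq> {v}"
      using edges_eq_loop[OF G that] by (auto simp: neighbours_def)
    with nb \<open>x \<noteq> y\<close> show False by auto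
  qed
  have "v \<notin> neighbours G v" using no_loop by (auto simp: neighbours_def)
  then have ne: "v \<noteq> x" "v \<noteq> y" using nb by auto
  define A where "A = {e \<in> edges G. ends G e = {v, x}}"
  define B where "B = {e \<in> edges G. ends G e = {v, y}}"
  have "x \<in> neighbours G v" "y \<in> neighbours G v" using nb by auto
  then have AB: "A \<noteq> {}" "B \<noteq> {}" "A \<inter> B = {}"
    using \<open>x \<noteq> y\<close> by (auto simp: neighbours_def A_def B_def insert_commute doubleton_eq_iff)
  have only: "e \<in> A \<union> B" if e: "e \<in> edges G" "v \<in> ends G e" for e
  proof -
    obtain a b where "ends G e = {a, b}" using edge_cases[OF G(1) e(1)] by metis
    with e(2) obtain u where u: "ends G e = {u, v}" by auto
    then have "u \<in> neighbours G v" using e(1) by (auto simp: neighbours_def)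
    with nb u e(1) show ?thesis by (auto simp: A_def B_def)
  qed
  have cut: "cut G {v} = A \<union> B"
    using only ne by (auto simp: cut_def A_def B_def)
  have sign: "has_sign G {e \<in> edges G. ends G e = {v, z}}" (is "has_sign G ?E") for z
  proof (rule ccontr)
    assume "\<not> has_sign G ?E"
    then obtain e f where "e \<in> ?E" "e \<in> neg G" "f \<in> ?E" "f \<notin> neg G"
      by (auto simp: has_sign_def)
    \<comment> \<open>Two parallel edges of opposite signs would be all of \<open>G\<close>, leaving
      \<open>z\<close> as the only neighbour of \<open>v\<close> apart from possibly
      \<open>v\<close> itself.\<close>
    then have "neighbours G v \<subseteq> {u. {u, v} = {v, z}}"
      using edges_eq_digon[OF G, of e f] by (auto simp: neighbours_def)
    with nb \<open>x \<noteq> y\<close> ne show False by (auto simp: doubleton_eq_iff)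
  qed
  have signs: "has_sign G A" "has_sign G B" using sign by (auto simp: A_def B_def)
  have "card B \<le> card A"
    using vertex_multiedge_card_le[OF G(1,2) cut AB(3) _ signs(2), of y] by (simp add: B_def)
  moreover have "card A \<le> card B"
  proof (rule vertex_multiedge_card_le[OF G(1,2) _ _ _ signs(1)])
    show "cut G {v} = B \<union> A" "B \<inter> A = {}" using cut AB(3) by auto
  qed (simp add: A_def)
  ultimately have card: "card A = card B" by simp
  \<comment> \<open>A subdivision makes the edges to \<open>x\<close> positive. If they are
    negative, switching at \<open>v\<close> repairs this and flips all of \<open>B\<close>, which
    keeps a common sign.\<close>
  define U where "U = (if A \<subseteq> neg G then {v} else {})"
  let ?G = "switch U G"
  have neg: "neg ?G = (if A \<subseteq> neg G then sym_diff (neg G) (A \<union> B) else neg G)"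
    using cut by (simp add: U_def neg_switch cut_def)
  have same: "verts ?G = verts G" "edges ?G = edges G" "ends ?G = ends G"
    by (simp_all add: switch_def)
  have "signed_graph ?G"
    using G(1) neg_switch_subset[OF G(1), of U] by (simp add: signed_graph_def same)
  moreover have "A \<inter> neg ?G = {}" using signs AB by (auto simp: neg has_sign_def)
  moreover have "has_sign ?G B" using signs AB by (auto simp: neg has_sign_def)
  ultimately obtain H :: "('v, 'e) sgraph" where "signed_graph H" "subdivide_step H ?G"
    using subdivide_step_exists[of ?G v x y A B] same v ne \<open>x \<noteq> y\<close> A_def B_def AB card only by metis
  moreover have "U \<subseteq> verts G" using v by (simp add: U_def)
  ultimately show "\<exists>H :: ('v, 'e) sgraph. signed_graph H \<and> proper_subdivision G H"
    unfolding proper_subdivision_def by blast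
qed

end
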